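(* Let $n\ge5$ and $c\ge1$. The symmetric group $S_n$ is a quotient of $UW_n(c)$. Moreover, every non-abelian finite quotient $G$ of $UW_n(c)$ satisfies $|G|\ge n!$, and if $|G|=n!$ then $G\cong S_n$; for $n\neq 6$, $S_n$ is the unique (up to isomorphism) quotient of order $n!$, while for $n=6$ there are also the quotients obtained by composing with the exceptional outer automorphism of $S_6$.
   Context: $UV_n(c)$ ($n\ge2$, $c\ge1$) is the group with generators $\rho_i$ ($1\le i\le n-1$), $\sigma_{i,t}$ ($1\le i\le n-1$, $1\le t\le c$) and relations $\rho_i\rho_{i+1}\rho_i=\rho_{i+1}\rho_i\rho_{i+1}$ ($1\le i\le n-2$), $\rho_i\rho_j=\rho_j\rho_i$ ($|i-j|\ge2$), $\rho_i^2=1$, $\sigma_{i,t}\sigma_{j,\ell}=\sigma_{j,\ell}\sigma_{i,t}$ ($|i-j|\ge2$, $1\le t,\ell\le c$), $\sigma_{i,t}\rho_j=\rho_j\sigma_{i,t}$ ($|i-j|\ge2$), $\rho_i\rho_{i+1}\sigma_{i,t}=\sigma_{i+1,t}\rho_i\rho_{i+1}$ ($1\le i\le n-2$, $1\le t\le c$). The universal welded braid group $UW_n(c)$ is the quotient of $UV_n(c)$ by the additional relations $\rho_i\sigma_{i+1,t}\sigma_{i,t}=\sigma_{i+1,t}\sigma_{i,t}\rho_{i+1}$ for all $1\le i\le n-2$, $1\le t\le c$. A quotient of a group means the image of a surjective homomorphism. *)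

theory Defs
  imports "HOL-Algebra.Sym_Groups" "HOL-Algebra.Generated_Groups"
begin

text \<open>Relations of the universal welded braid group UW_n(c), for images
  rho i (1 <= i <= n-1) and sigma i t (1 <= i <= n-1, 1 <= t <= c) of the
  generators in a group G.\<close>

definition UW_relations ::
  "('g, 'b) monoid_scheme \<Rightarrow> nat \<Rightarrow> nat \<Rightarrow> (nat \<Rightarrow> 'g) \<Rightarrow> (nat \<Rightarrow> nat \<Rightarrow> 'g) \<Rightarrow> bool" where
  "UW_relations G n c rho sigma \<longleftrightarrow>
     (\<forall>i\<in>{1..<n}. rho i \<in> carrier G) \<and>
     (\<forall>i\<in>{1..<n}. \<forall>t\<in>{1..c}. sigma i t \<in> carrier G) \<and>
     \<comment> \<open>rho_i rho_{i+1} rho_i = rho_{i+1} rho_i rho_{i+1}\<close>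
     (\<forall>i\<in>{1..n-2}. rho i \<otimes>\<^bsub>G\<^esub> rho (i+1) \<otimes>\<^bsub>G\<^esub> rho i
                     = rho (i+1) \<otimes>\<^bsub>G\<^esub> rho i \<otimes>\<^bsub>G\<^esub> rho (i+1)) \<and>
     \<comment> \<open>rho_i rho_j = rho_j rho_i for |i-j| >= 2\<close>
     (\<forall>i\<in>{1..<n}. \<forall>j\<in>{1..<n}. 2 \<le> nat \<bar>int i - int j\<bar> \<longrightarrow>
        rho i \<otimes>\<^bsub>G\<^esub> rho j = rho j \<otimes>\<^bsub>G\<^esub> rho i) \<and>
     \<comment> \<open>rho_i^2 = 1\<close>
     (\<forall>i\<in>{1..<n}. rho i \<otimes>\<^bsub>G\<^esub> rho i = \<one>\<^bsub>G\<^esub>) \<and>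
     \<comment> \<open>sigma_{i,t} sigma_{j,l} = sigma_{j,l} sigma_{i,t} for |i-j| >= 2\<close>
     (\<forall>i\<in>{1..<n}. \<forall>j\<in>{1..<n}. \<forall>t\<in>{1..c}. \<forall>l\<in>{1..c}. 2 \<le> nat \<bar>int i - int j\<bar> \<longrightarrow>
        sigma i t \<otimes>\<^bsub>G\<^esub> sigma j l = sigma j l \<otimes>\<^bsub>G\<^esub> sigma i t) \<and>
     \<comment> \<open>sigma_{i,t} rho_j = rho_j sigma_{i,t} for |i-j| >= 2\<close>
     (\<forall>i\<in>{1..<n}. \<forall>j\<in>{1..<n}. \<forall>t\<in>{1..c}. 2 \<le> nat \<bar>int i - int j\<bar> \<longrightarrow>
        sigma i t \<otimes>\<^bsub>G\<^esub> rho j = rho j \<otimes>\<^bsub>G\<^esub> sigma i t) \<and>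
     \<comment> \<open>rho_i rho_{i+1} sigma_{i,t} = sigma_{i+1,t} rho_i rho_{i+1}\<close>
     (\<forall>i\<in>{1..n-2}. \<forall>t\<in>{1..c}.
        rho i \<otimes>\<^bsub>G\<^esub> rho (i+1) \<otimes>\<^bsub>G\<^esub> sigma i t
          = sigma (i+1) t \<otimes>\<^bsub>G\<^esub> rho i \<otimes>\<^bsub>G\<^esub> rho (i+1)) \<and>
     \<comment> \<open>welded relation: rho_i sigma_{i+1,t} sigma_{i,t} = sigma_{i+1,t} sigma_{i,t} rho_{i+1}\<close>
     (\<forall>i\<in>{1..n-2}. \<forall>t\<in>{1..c}.
        rho i \<otimes>\<^bsub>G\<^esub> sigma (i+1) t \<otimes>\<^bsub>G\<^esub> sigma i t
          = sigma (i+1) t \<otimes>\<^bsub>G\<^esub> sigma i t \<otimes>\<^bsub>G\<^esub> rho (i+1))"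

text \<open>A surjective homomorphism UW_n(c) -> G, given (von Dyck) by the images of
  the generators: they satisfy the defining relations and generate G.\<close>

definition UW_epi ::
  "('g, 'b) monoid_scheme \<Rightarrow> nat \<Rightarrow> nat \<Rightarrow> (nat \<Rightarrow> 'g) \<Rightarrow> (nat \<Rightarrow> nat \<Rightarrow> 'g) \<Rightarrow> bool" where
  "UW_epi G n c rho sigma \<longleftrightarrow> group G \<and> UW_relations G n c rho sigma \<and>
     generate G (rho ` {1..<n} \<union> (\<lambda>(i, t). sigma i t) ` ({1..<n} \<times> {1..c})) = carrier G"

definition UW_quotient :: "('g, 'b) monoid_scheme \<Rightarrow> nat \<Rightarrow> nat \<Rightarrow> bool" where
  "UW_quotient G n c \<longleftrightarrow> (\<exists>rho sigma. UW_epi G n c rho sigma)"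

definition std_rho :: "nat \<Rightarrow> (nat \<Rightarrow> nat)" where
  "std_rho i = Transposition.transpose i (Suc i)"

definition std_sigma :: "nat \<Rightarrow> nat \<Rightarrow> (nat \<Rightarrow> nat)" where
  "std_sigma i t = Transposition.transpose i (Suc i)"

definition conj_by :: "('g, 'b) monoid_scheme \<Rightarrow> 'g \<Rightarrow> 'g \<Rightarrow> 'g" where
  "conj_by G p x = p \<otimes>\<^bsub>G\<^esub> x \<otimes>\<^bsub>G\<^esub> inv\<^bsub>G\<^esub> p"

end

theory Submission
  imports Defs
begin

text \<open>The generators rho satisfy the Coxeter relations, so they define a homomorphism from the
  symmetric group. If it is not injective, its kernel contains a 3-cycle for \<open>n \<ge> 5\<close>, all rho
  coincide, the mixed relations make all sigma with the same second index coincide, and the far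
  commutation relations force the quotient to be abelian. Hence a non-abelian quotient contains
  a copy of the symmetric group. When the quotient is the symmetric group itself, this
  homomorphism is an automorphism; as sigma 1 t centralizes rho 3, \<open>\<dots>\<close>, rho (n - 1) it is 1 or
  rho 1, and the welded relation excludes 1. Automorphisms are inner for \<open>n \<noteq> 6\<close>
  because a transposition is characterized among involutions by the fact that its product with
  any of its conjugates has order at most 3.\<close>

section \<open>The Coxeter presentation of the symmetric group\<close>

text \<open>A predicate on a family of elements of any group, so that it applies alike to
  \<open>sym_group n\<close>, to \<open>G\<close> and to their direct product, and passes to smaller
  \<open>n\<close>.\<close>

definition coxeter_relations ::
  "('g, 'b) monoid_scheme \<Rightarrow> nat \<Rightarrow> (nat \<Rightarrow> 'g) \<Rightarrow> bool" where
  "coxeter_relations G n r \<longleftrightarrow>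
     (\<forall>i. 1 \<le> i \<and> i < n \<longrightarrow> r i \<in> carrier G \<and> r i \<otimes>\<^bsub>G\<^esub> r i = \<one>\<^bsub>G\<^esub>) \<and>
     (\<forall>i. 1 \<le> i \<and> Suc i < n \<longrightarrow>
        r i \<otimes>\<^bsub>G\<^esub> r (Suc i) \<otimes>\<^bsub>G\<^esub> r i = r (Suc i) \<otimes>\<^bsub>G\<^esub> r i \<otimes>\<^bsub>G\<^esub> r (Suc i)) \<and>
     (\<forall>i j. 1 \<le> i \<and> Suc i < j \<and> j < n \<longrightarrow> r i \<otimes>\<^bsub>G\<^esub> r j = r j \<otimes>\<^bsub>G\<^esub> r i)"

lemma UW_relations_imp_coxeter:
  assumes "UW_relations G n c rho sigma"
  shows "coxeter_relations G n rho"
  using assms unfolding UW_relations_def coxeter_relations_def by auto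

context group
begin

text \<open>The product r j \<otimes> r (j + 1) \<otimes> \<dots> \<otimes> r (j + d - 1), a coset representative of the
  subgroup generated by r 1, \<dots>, r (j + d - 2).\<close>

fun run :: "(nat \<Rightarrow> 'a) \<Rightarrow> nat \<Rightarrow> nat \<Rightarrow> 'a" where
  "run r j 0 = \<one>"
| "run r j (Suc d) = r j \<otimes> run r (Suc j) d"

lemma run_closed:
  "(\<And>i. j \<le> i \<Longrightarrow> i < j + d \<Longrightarrow> r i \<in> carrier G) \<Longrightarrow> run r j d \<in> carrier G"
  by (induction d arbitrary: j) auto

lemma run_commute:
  assumes "x \<in> carrier G"
    and "\<And>i. j \<le> i \<Longrightarrow> i < j + d \<Longrightarrow> r i \<in> carrier G \<and> x \<otimes> r i = r i \<otimes> x"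
  shows "x \<otimes> run r j d = run r j d \<otimes> x"
  using assms(2)
proof (induction d arbitrary: j)
  case 0
  then show ?case using assms(1) by simp
next
  case (Suc d)
  have IH: "x \<otimes> run r (Suc j) d = run r (Suc j) d \<otimes> x"
    using Suc.prems by (intro Suc.IH) auto
  have rj: "r j \<in> carrier G" "x \<otimes> r j = r j \<otimes> x"
    using Suc.prems[of j] by auto
  have cl: "run r (Suc j) d \<in> carrier G"
    using Suc.prems by (intro run_closed) auto
  have "x \<otimes> run r j (Suc d) = (x \<otimes> r j) \<otimes> run r (Suc j) d"
    using assms(1) rj(1) cl by (simp add: m_assoc)
  also have "\<dots> = r j \<otimes> (x \<otimes> run r (Suc j) d)"
    using assms(1) rj cl by (simp add: m_assoc)
  also have "\<dots> = run r j (Suc d) \<otimes> x"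
    using assms(1) rj(1) cl by (simp add: IH m_assoc)
  finally show ?case .
qed

text \<open>The letter \<open>r i\<close> commutes past the factors before \<open>r (i - 1)\<close>;
  there the braid relation turns \<open>r i\<close>, \<open>r (i - 1)\<close>, \<open>r i\<close>
  into \<open>r (i - 1)\<close>, \<open>r i\<close>, \<open>r (i - 1)\<close>, and the last letter
  commutes with the remaining factors. The induction strips off one factor at a time.\<close>

lemma run_shift:
  assumes "coxeter_relations G (j + d) r" "1 \<le> j" "j < i" "i < j + d"
  shows "r i \<otimes> run r j d = run r j d \<otimes> r (i - 1)"
  using assms
proof (induction d arbitrary: j)
  case 0
  then show ?case by simp
next
  case (Suc d)
  note cox = Suc.prems(1)[unfolded coxeter_relations_def]
  have rcl: "r k \<in> carrier G" if "1 \<le> k" "k < j + Suc d" for k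
    using cox that by blast
  have cl: "r j \<in> carrier G" "r i \<in> carrier G" "r (i - 1) \<in> carrier G"
    using Suc.prems by (auto intro: rcl)
  have cl': "run r (Suc j) d \<in> carrier G"
    using Suc.prems by (intro run_closed rcl) auto
  show ?case
  proof (cases "i = Suc j")
    case True
    then obtain d' where d: "d = Suc d'"
      using Suc.prems by (cases d) auto
    have cl'': "run r (Suc i) d' \<in> carrier G"
      using Suc.prems True d by (intro run_closed rcl) auto
    have comm: "r j \<otimes> run r (Suc i) d' = run r (Suc i) d' \<otimes> r j"
    proof (rule run_commute[OF cl(1)])
      fix k assume "Suc i \<le> k" "k < Suc i + d'"
      then have "1 \<le> j \<and> Suc j < k \<and> k < j + Suc d"
        using Suc.prems True d by auto
      then show "r k \<in> carrier G \<and> r j \<otimes> r k = r k \<otimes> r j"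
        using cox rcl[of k] by auto
    qed
    have braid: "r j \<otimes> (r i \<otimes> r j) = r i \<otimes> (r j \<otimes> r i)"
      using cox Suc.prems cl True by (simp add: m_assoc[symmetric])
    have "r i \<otimes> run r j (Suc d) = (r i \<otimes> (r j \<otimes> r i)) \<otimes> run r (Suc i) d'"
      using cl cl'' True d by (simp add: m_assoc)
    also have "\<dots> = r j \<otimes> (r i \<otimes> (r j \<otimes> run r (Suc i) d'))"
      unfolding braid[symmetric] using cl cl'' by (simp add: m_assoc)
    also have "\<dots> = run r j (Suc d) \<otimes> r (i - 1)"
      unfolding comm using cl cl'' True d by (simp add: m_assoc)
    finally show ?thesis .
  next
    case False
    have IH: "r i \<otimes> run r (Suc j) d = run r (Suc j) d \<otimes> r (i - 1)"
      using Suc.prems False by (intro Suc.IH) auto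
    have comm: "r i \<otimes> r j = r j \<otimes> r i"
      using cox Suc.prems False by (metis Suc_lessI)
    have "r i \<otimes> run r j (Suc d) = (r i \<otimes> r j) \<otimes> run r (Suc j) d"
      using cl cl' by (simp add: m_assoc)
    also have "\<dots> = r j \<otimes> (r i \<otimes> run r (Suc j) d)"
      unfolding comm using cl cl' by (simp add: m_assoc)
    also have "\<dots> = run r j (Suc d) \<otimes> r (i - 1)"
      unfolding IH using cl cl' by (simp add: m_assoc)
    finally show ?thesis .
  qed
qed

text \<open>Coset enumeration: one more generator multiplies the order by at most
  \<open>Suc n\<close>, because \<open>Suc n\<close> left translates of the previous subgroup
  \<open>H\<close> are together stable under left multiplication by all generators.\<close>

lemma card_generate_coxeter:
  assumes "coxeter_relations G n r"
  shows "finite (generate G (r ` {1..<n})) \<and> card (generate G (r ` {1..<n})) \<le> fact n"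
  using assms
proof (induction n)
  case 0
  then show ?case by (simp add: generate_empty)
next
  case (Suc n)
  note cox = Suc.prems[unfolded coxeter_relations_def]
  have rcl: "r k \<in> carrier G" if "1 \<le> k" "k < Suc n" for k
    using cox that by blast
  have inv_r: "inv (r k) = r k" if "1 \<le> k" "k < Suc n" for k
    using cox that rcl[OF that] by (metis inv_equality)
  define H where "H = generate G (r ` {1..<n})"
  have "coxeter_relations G n r"
    using cox unfolding coxeter_relations_def by (meson less_SucI)
  then have fin: "finite H" and card_H: "card H \<le> fact n"
    using Suc.IH unfolding H_def by auto
  have H_sub: "r ` {1..<n} \<subseteq> carrier G"
    using rcl by auto
  have Hcl: "h \<in> carrier G" if "h \<in> H" for h
    using generate_in_carrier[OF H_sub] that unfolding H_def by simp
  have rH: "r k \<otimes> h \<in> H" if "1 \<le> k" "k < n" "h \<in> H" for k h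
    using that unfolding H_def by (intro generate.eng[OF generate.incl]) auto
  \<comment> \<open>\<open>w j\<close> is the product of \<open>r j\<close> up to
    \<open>r n\<close>, and \<open>w (Suc n)\<close> is the empty product.\<close>
  define w where "w j = run r j (Suc n - j)" for j
  have wcl: "w j \<in> carrier G" if "1 \<le> j" "j \<le> Suc n" for j
    unfolding w_def using that by (intro run_closed rcl) auto
  have w_step: "w j = r j \<otimes> w (Suc j)" if "1 \<le> j" "j \<le> n" for j
  proof -
    have "Suc n - j = Suc (Suc n - Suc j)" using that by simp
    then show ?thesis unfolding w_def by (metis run.simps(2))
  qed
  define U where "U = (\<lambda>(j, h). w j \<otimes> h) ` ({1..Suc n} \<times> H)"
  have U_I: "w j \<otimes> h \<in> U" if "1 \<le> j" "j \<le> Suc n" "h \<in> H" for j h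
    using that unfolding U_def by force
  have step: "r i \<otimes> u \<in> U" if i: "1 \<le> i" "i < Suc n" and u: "u \<in> U" for i u
  proof -
    obtain j h where jh: "1 \<le> j" "j \<le> Suc n" "h \<in> H" "u = w j \<otimes> h"
      using u unfolding U_def by auto
    note cl = rcl[OF i] wcl[OF jh(1,2)] Hcl[OF jh(3)]
    \<comment> \<open>The letter \<open>r i\<close> cancels the first factor of \<open>w j\<close>,
      or prolongs \<open>w j\<close> by one factor, or passes through \<open>w j\<close> unchanged,
      or passes through it as \<open>r (i - 1)\<close>. In the last two cases the letter that comes
      out is a generator of \<open>H\<close>.\<close>
    consider "i = j" | "Suc i = j" | "Suc i < j" | "j < i" by linarith
    then show ?thesis
    proof cases
      case 1
      have cl': "w (Suc j) \<in> carrier G" using 1 i jh by (intro wcl) auto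
      have "r i \<otimes> u = (r i \<otimes> r i) \<otimes> (w (Suc j) \<otimes> h)"
        using 1 i cl cl' jh w_step[of j] by (simp add: m_assoc)
      also have "\<dots> = w (Suc j) \<otimes> h"
        using cox i cl cl' by simp
      finally show ?thesis using U_I[of "Suc j" h] 1 i jh by simp
    next
      case 2
      then have "r i \<otimes> u = w i \<otimes> h"
        using jh cl w_step[of i] i by (simp add: m_assoc)
      then show ?thesis using U_I[of i h] i jh by simp
    next
      case 3
      have "r i \<otimes> w j = w j \<otimes> r i"
        unfolding w_def using 3 i jh cox rcl by (intro run_commute[OF cl(1)]) auto
      then have "r i \<otimes> u = w j \<otimes> (r i \<otimes> h)"
        using jh cl by (simp add: m_assoc[symmetric])
      then show ?thesis using U_I[of j "r i \<otimes> h"] rH[of i h] 3 i jh by simp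
    next
      case 4
      have "r i \<otimes> w j = w j \<otimes> r (i - 1)"
        unfolding w_def using 4 i jh Suc.prems by (intro run_shift) auto
      moreover have "r (i - 1) \<in> carrier G" using 4 i jh by (intro rcl) auto
      ultimately have "r i \<otimes> u = w j \<otimes> (r (i - 1) \<otimes> h)"
        using jh cl by (metis m_assoc)
      then show ?thesis using U_I[of j "r (i - 1) \<otimes> h"] rH[of "i - 1" h] 4 i jh by simp
    qed
  qed
  have Ucl: "u \<in> carrier G" if "u \<in> U" for u
    using that wcl Hcl unfolding U_def by auto
  have sub: "r ` {1..<Suc n} \<subseteq> carrier G" using rcl by auto
  have closed: "x \<otimes> u \<in> U" if "x \<in> generate G (r ` {1..<Suc n})" "u \<in> U" for x u
    using that
  proof (induction arbitrary: u rule: generate.induct)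
    case one
    then show ?case using Ucl by simp
  next
    case (incl h)
    then show ?case using step by auto
  next
    case (inv h)
    then show ?case using step inv_r by auto
  next
    case (eng x y)
    then show ?case
      using generate_in_carrier[OF sub] Ucl by (simp add: m_assoc)
  qed
  have "\<one> \<in> U"
    using U_I[of "Suc n" \<one>] generate.one[of G] unfolding H_def w_def by simp
  then have "generate G (r ` {1..<Suc n}) \<subseteq> U"
    using closed[of _ \<one>] generate_in_carrier[OF sub] by (metis r_one subsetI)
  moreover have "finite U" unfolding U_def using fin by simp
  moreover have "card U \<le> fact (Suc n)"
  proof -
    have "card U \<le> card ({1..Suc n} \<times> H)"
      unfolding U_def by (rule card_image_le) (simp add: fin)
    also have "\<dots> \<le> Suc n * fact n"
      unfolding card_cartesian_product using mult_le_mono2[OF card_H, of "Suc n"] by simp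
    finally show ?thesis by simp
  qed
  ultimately show ?case
    using card_mono finite_subset le_trans by metis
qed

end

section \<open>Symmetric groups\<close>

lemma std_rho_permutes: "1 \<le> i \<Longrightarrow> i < n \<Longrightarrow> std_rho i permutes {1..n}"
  unfolding std_rho_def by (intro permutes_swap_id) auto

lemma std_rho_coxeter: "coxeter_relations (sym_group n) n std_rho"
  unfolding coxeter_relations_def
  by (auto simp: sym_group_carrier sym_group_mult sym_group_one)
     (auto simp: std_rho_def fun_eq_iff transpose_def intro!: permutes_swap_id)

text \<open>Conjugating \<open>transpose a b\<close> by the adjacent transposition of
  \<open>b\<close> and \<open>Suc b\<close> raises \<open>b\<close> by one, which yields all
  transpositions, and these generate.\<close>

lemma generate_std_rho: "generate (sym_group n) (std_rho ` {1..<n}) = carrier (sym_group n)"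
proof -
  interpret group "sym_group n" by (rule sym_group_is_group)
  let ?H = "generate (sym_group n) (std_rho ` {1..<n})"
  have mult: "p \<circ> q \<in> ?H" if "p \<in> ?H" "q \<in> ?H" for p q
    using generate.eng[OF that] by (simp add: sym_group_mult)
  have "id \<in> ?H" using generate.one[of "sym_group n"] by (simp add: sym_group_one)
  have adj: "transpose i (Suc i) \<in> ?H" if "1 \<le> i" "i < n" for i
    using that unfolding std_rho_def[symmetric] by (intro generate.incl) auto
  have lt: "transpose a b \<in> ?H" if "1 \<le> a" "a < b" "b \<le> n" for a b
    using that
  proof (induction b)
    case (Suc b)
    show ?case
    proof (cases "a = b")
      case True
      then show ?thesis using adj Suc.prems by simp
    next
      case False
      then have "transpose a (Suc b) = transpose b (Suc b) \<circ> transpose a b \<circ> transpose b (Suc b)"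
        using Suc.prems by (auto simp: fun_eq_iff transpose_def)
      also have "\<dots> \<in> ?H" using Suc False by (intro mult adj Suc.IH) auto
      finally show ?thesis .
    qed
  qed simp
  have tr: "transpose a b \<in> ?H" if "a \<in> {1..n}" "b \<in> {1..n}" for a b
    using that lt[of a b] lt[of b a] \<open>id \<in> ?H\<close>
    by (cases a b rule: linorder_cases) (auto simp: transpose_commute)
  have "p \<in> ?H" if "p permutes {1..n}" for p
    using that finite_atLeastAtMost
  proof (induction p rule: permutes_induct)
    case id
    show ?case using \<open>id \<in> ?H\<close> .
  next
    case (swap a b p)
    then show ?case by (intro mult tr) auto
  qed
  moreover have "?H \<subseteq> carrier (sym_group n)"
    using std_rho_permutes[of _ n] by (intro generate_incl) (auto simp: sym_group_carrier)
  ultimately show ?thesis by (auto simp: sym_group_carrier)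
qed

text \<open>The subgroup of the direct product generated by the pairs of generators has at most
  \<open>n!\<close> elements and projects onto the symmetric group, so it is the graph of a homomorphism.\<close>

lemma coxeter_hom:
  assumes "group G" and cox: "coxeter_relations G n r"
  obtains f where "f \<in> hom (sym_group n) G" "\<And>i. 1 \<le> i \<Longrightarrow> i < n \<Longrightarrow> f (std_rho i) = r i"
proof -
  let ?S = "sym_group n" and ?P = "sym_group n \<times>\<times> G"
  let ?g = "\<lambda>i. (std_rho i, r i)"
  interpret S: group ?S by (rule sym_group_is_group)
  interpret G: group G by fact
  interpret P: group ?P by (intro DirProd_group S.group_axioms G.group_axioms)
  define K where "K = generate ?P (?g ` {1..<n})"
  have coxP: "coxeter_relations ?P n ?g"
    using cox std_rho_coxeter[of n] unfolding coxeter_relations_def by auto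
  then have gP: "?g ` {1..<n} \<subseteq> carrier ?P"
    unfolding coxeter_relations_def by auto
  have fin: "finite K" and card_K: "card K \<le> fact n"
    using P.card_generate_coxeter[OF coxP] unfolding K_def by auto
  have K: "subgroup K ?P"
    unfolding K_def by (rule P.generate_is_subgroup[OF gP])
  have "group_hom ?P ?S fst"
    by unfold_locales (auto simp: hom_def)
  from group_hom.generate_img[OF this gP]
  have img: "fst ` K = carrier ?S"
    using generate_std_rho[of n] unfolding K_def by (simp add: image_image)
  then have "card (fst ` K) = fact n" by (simp add: sym_group_card_carrier)
  then have inj: "inj_on fst K"
    using card_K card_image_le[OF fin, of fst] by (intro eq_card_imp_inj_on[OF fin]) simp
  define f where "f p = snd (inv_into K fst p)" for p
  have graph: "(p, f p) \<in> K" if "p \<in> carrier ?S" for p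
    using that img inv_into_into[of p fst K] f_inv_into_f[of p fst K]
    unfolding f_def by (metis prod.collapse)
  have uniq: "f p = x" if "(p, x) \<in> K" for p x
    unfolding f_def using inv_into_f_f[OF inj that] by simp
  have Kcl: "x \<in> carrier G" if "(p, x) \<in> K" for p x
    using subgroup.subset[OF K] that by auto
  show ?thesis
  proof
    show "f \<in> hom ?S G"
    proof (rule homI)
      fix p q assume pq: "p \<in> carrier ?S" "q \<in> carrier ?S"
      show "f p \<in> carrier G" using graph[OF pq(1)] Kcl by blast
      show "f (p \<otimes>\<^bsub>?S\<^esub> q) = f p \<otimes>\<^bsub>G\<^esub> f q"
        using subgroup.m_closed[OF K graph[OF pq(1)] graph[OF pq(2)]] by (intro uniq) simp
    qed
    fix i :: nat assume "1 \<le> i" "i < n"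
    then have "?g i \<in> K" unfolding K_def by (intro generate.incl) auto
    then show "f (std_rho i) = r i" by (rule uniq)
  qed
qed

section \<open>Conjugates of transpositions and permutations with prescribed values\<close>

lemma conj_transpose:
  assumes "inj p"
  shows "p \<circ> transpose a b = transpose (p a) (p b) \<circ> p"
  using assms by (auto simp: fun_eq_iff transpose_def inj_eq)

text \<open>The complements of \<open>A\<close> and of its image have the same finite size, so any
  bijection between them completes \<open>g\<close>. This supplies conjugating permutations that are
  prescribed on a few points only.\<close>

lemma permutes_extends:
  assumes "finite S" "A \<subseteq> S" "g ` A \<subseteq> S" "inj_on g A"
  obtains p where "p permutes S" "\<And>a. a \<in> A \<Longrightarrow> p a = g a"
proof -
  have "card (S - A) = card (S - g ` A)"
    using assms by (simp add: card_Diff_subset card_image finite_subset)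
  then obtain h where h: "bij_betw h (S - A) (S - g ` A)"
    using assms(1) finite_same_card_bij by blast
  define p where "p x = (if x \<in> A then g x else if x \<in> S then h x else x)" for x
  have "bij_betw p A (g ` A)"
    using assms(4) by (auto simp: bij_betw_def p_def cong: inj_on_cong)
  moreover have "bij_betw p (S - A) (S - g ` A)"
    using h by (rule iffD1[OF bij_betw_cong, rotated]) (auto simp: p_def)
  ultimately have "bij_betw p (A \<union> (S - A)) (g ` A \<union> (S - g ` A))"
    by (rule bij_betw_combine) auto
  then have "bij_betw p S S"
    using assms(2,3) by (simp add: Un_absorb1)
  then have "p permutes S"
    by (rule bij_imp_permutes) (use assms(2) in \<open>auto simp: p_def\<close>)
  then show ?thesis
    by (rule that) (simp add: p_def)
qed

lemma transpose_in_sym_group: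
  "a \<in> {1..n} \<Longrightarrow> b \<in> {1..n} \<Longrightarrow> transpose a b \<in> carrier (sym_group n)"
  by (simp add: sym_group_carrier permutes_swap_id)

lemma conj_by_transpose:
  assumes "p \<in> carrier (sym_group n)"
  shows "conj_by (sym_group n) p (transpose a b) = transpose (p a) (p b)"
proof -
  have p: "p permutes {1..n}" using assms by (simp add: sym_group_carrier)
  have "p \<circ> transpose a b \<circ> inv' p = transpose (p a) (p b) \<circ> (p \<circ> inv' p)"
    using conj_transpose[OF permutes_inj[OF p]] by (simp add: comp_assoc)
  then show ?thesis
    using assms p by (simp add: conj_by_def sym_group_mult permutes_inv_o)
qed

text \<open>Points to be avoided come as a list, so that the length bounds their number even when
  some of them coincide.\<close>

lemma ex_fresh:
  fixes n :: nat
  assumes "length xs < n"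
  obtains x where "x \<in> {1..n}" "x \<notin> set xs"
proof -
  have "card (set xs) < card {1..n}"
    using card_length[of xs] assms by simp
  then have "\<not> {1..n} \<subseteq> set xs"
    by (metis List.finite_set card_mono not_less)
  then show ?thesis using that by blast
qed

section \<open>Homomorphisms out of the symmetric group\<close>

locale sym_group_hom = group_hom "sym_group n" G f for n G f
begin

lemma hom_conj_transpose:
  assumes "p \<in> carrier (sym_group n)" "a \<in> {1..n}" "b \<in> {1..n}"
  shows "f (transpose (p a) (p b)) = f p \<otimes>\<^bsub>G\<^esub> f (transpose a b) \<otimes>\<^bsub>G\<^esub> inv\<^bsub>G\<^esub> f p"
proof -
  have "transpose (p a) (p b) =
      p \<otimes>\<^bsub>sym_group n\<^esub> transpose a b \<otimes>\<^bsub>sym_group n\<^esub> inv\<^bsub>sym_group n\<^esub> p"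
    using conj_by_transpose[OF assms(1)] by (simp only: conj_by_def)
  then show ?thesis
    using assms transpose_in_sym_group[OF assms(2,3)]
    by (simp only: hom_mult hom_inv G.m_closed G.inv_closed)
qed

text \<open>Conjugating a transposition by a non-trivial kernel element yields two transpositions with
  the same image, and conjugating further one may take them to share a point.\<close>

lemma adjacent_images_eq:
  assumes "5 \<le> n" "\<not> inj_on f (carrier (sym_group n))" "1 \<le> i" "Suc i < n"
  shows "f (std_rho i) = f (std_rho (Suc i))"
proof -
  have transfer: "f (transpose (p x) (p y)) = f (transpose (p z) (p w))"
    if "f (transpose x y) = f (transpose z w)" "p \<in> carrier (sym_group n)"
      "x \<in> {1..n}" "y \<in> {1..n}" "z \<in> {1..n}" "w \<in> {1..n}" for p x y z w
    using that by (simp only: hom_conj_transpose)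
  obtain k where k: "k \<in> carrier (sym_group n)" "f k = \<one>\<^bsub>G\<^esub>" "k \<noteq> id"
    using assms(2) inj_on_one_iff by (auto simp: sym_group_one)
  then have kp: "k permutes {1..n}" by (simp add: sym_group_carrier)
  obtain a where a: "k a \<noteq> a" using k(3) by (auto simp: fun_eq_iff)
  have an: "a \<in> {1..n}" using a permutes_not_in[OF kp] by blast
  \<comment> \<open>Avoiding \<open>inv' k a\<close> ensures that \<open>k c\<close> is not
    \<open>a\<close>; hence the pairs \<open>a\<close>, \<open>c\<close> and \<open>k a\<close>,
    \<open>k c\<close> can only meet in \<open>c = k c\<close>.\<close>
  obtain c where c: "c \<in> {1..n}" "c \<notin> set [a, k a, inv' k a]"
    using assms(1) by (rule_tac ex_fresh[of "[a, k a, inv' k a]" n]) auto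
  let ?b = "k a" and ?d = "k c"
  have d: "?d \<noteq> a" using c permutes_inverses(2)[OF kp, of c] by auto
  have bd: "?b \<noteq> ?d" using c permutes_inj[OF kp] by (auto simp: inj_eq)
  have mem: "?b \<in> {1..n}" "?d \<in> {1..n}"
    using an c permutes_in_image[OF kp] by auto
  have eq: "f (transpose ?b ?d) = f (transpose a c)"
    using hom_conj_transpose[OF k(1) an c(1)] k(2) transpose_in_sym_group[OF an c(1)]
      hom_closed by simp
  obtain x y z where xyz: "x \<in> {1..n}" "y \<in> {1..n}" "z \<in> {1..n}" "x \<noteq> y" "x \<noteq> z" "y \<noteq> z"
    and f_eq: "f (transpose x y) = f (transpose x z)"
  \<comment> \<open>If \<open>k\<close> fixes \<open>c\<close>, the two transpositions already share
    \<open>c\<close>. Otherwise conjugation by \<open>transpose ?d e\<close> with a fresh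
    \<open>e\<close> fixes \<open>transpose a c\<close> and turns \<open>transpose ?b ?d\<close>
    into \<open>transpose ?b e\<close>, so these two have the same image and share
    \<open>?b\<close>.\<close>
  proof (cases "?d = c")
    case True
    then show ?thesis
      using that[of c a ?b] eq a c an mem by (auto simp: transpose_commute)
  next
    case False
    obtain e where e: "e \<in> {1..n}" "e \<notin> set [a, ?b, c, ?d]"
      using assms(1) by (rule_tac ex_fresh[of "[a, ?b, c, ?d]" n]) auto
    have "f (transpose ?b e) = f (transpose a c)"
      using transfer[OF eq transpose_in_sym_group[OF mem(2) e(1)]] e mem an c a d bd False by auto
    then have "f (transpose ?b ?d) = f (transpose ?b e)" using eq by simp
    then show ?thesis
      using that[of ?b ?d e] mem e bd by auto
  qed
  \<comment> \<open>The default value \<open>i\<close> is the value at \<open>y\<close>; the common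
    point \<open>x\<close> goes to the middle point \<open>Suc i\<close>.\<close>
  define g where "g = (\<lambda>_. i)(x := Suc i, z := Suc (Suc i))"
  obtain p where p: "p permutes {1..n}" "\<And>u. u \<in> {x, y, z} \<Longrightarrow> p u = g u"
    by (rule permutes_extends[of "{1..n}" "{x, y, z}" g])
       (use xyz assms in \<open>auto simp: g_def inj_on_def\<close>)
  have "p x = Suc i" "p y = i" "p z = Suc (Suc i)"
    using p(2) xyz by (auto simp: g_def)
  then show ?thesis
    using transfer[OF f_eq, of p] p(1) xyz
    by (auto simp: std_rho_def sym_group_carrier transpose_commute)
qed

end

section \<open>Commutativity when all rho coincide\<close>

lemma (in group) comm_group_generate:
  assumes "H \<subseteq> carrier G" "generate G H = carrier G"
    and "\<And>x y. x \<in> H \<Longrightarrow> y \<in> H \<Longrightarrow> x \<otimes> y = y \<otimes> x"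
  shows "comm_group G"
proof -
  have ext: "x \<otimes> y = y \<otimes> x"
    if "y \<in> generate G H" "x \<in> carrier G" "\<And>h. h \<in> H \<Longrightarrow> x \<otimes> h = h \<otimes> x" for x y
    using that(1)
  proof induction
    case one
    then show ?case using that(2) by simp
  next
    case (incl h)
    then show ?case using that(3) by simp
  next
    case (inv h)
    then have h: "h \<in> carrier G" using assms(1) by blast
    have "inv h \<otimes> (x \<otimes> h) \<otimes> inv h = inv h \<otimes> (h \<otimes> x) \<otimes> inv h"
      using that(3)[OF inv] by simp
    then show ?case using h that(2) by (simp add: m_assoc inv_solve_left)
  next
    case (eng y z)
    then have "y \<in> carrier G" "z \<in> carrier G"
      using generate_in_carrier[OF assms(1)] by auto
    then show ?case using eng.IH that(2) by (metis m_assoc)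
  qed
  \<comment> \<open>\<open>ext\<close> is used twice: first to make each generator commute with the
    whole group, then to make each element do so.\<close>
  have "x \<otimes> h = h \<otimes> x" if "x \<in> carrier G" "h \<in> H" for x h
    using ext[of x h] that assms by (metis subsetD)
  then have "x \<otimes> y = y \<otimes> x" if "x \<in> carrier G" "y \<in> carrier G" for x y
    using ext[of y x] that assms(2) by auto
  then show ?thesis by unfold_locales auto
qed

text \<open>Bracketed so that \<open>rho i\<close> times \<open>rho (Suc i)\<close> can be cancelled
  on the right: conjugation by this product carries each sigma to the next, so
  \<open>sigma 1 t\<close> and the rho determine every \<open>sigma i t\<close>.\<close>

lemma UW_sigma_step:
  assumes "group G" "UW_relations G n c rho sigma" "1 \<le> i" "Suc i < n" "t \<in> {1..c}"
  shows "rho i \<otimes>\<^bsub>G\<^esub> rho (Suc i) \<otimes>\<^bsub>G\<^esub> sigma i t =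
    sigma (Suc i) t \<otimes>\<^bsub>G\<^esub> (rho i \<otimes>\<^bsub>G\<^esub> rho (Suc i))"
proof -
  interpret group G by fact
  have "i \<in> {1..n-2}" using assms by auto
  then have "rho i \<otimes>\<^bsub>G\<^esub> rho (i+1) \<otimes>\<^bsub>G\<^esub> sigma i t
          = sigma (i+1) t \<otimes>\<^bsub>G\<^esub> rho i \<otimes>\<^bsub>G\<^esub> rho (i+1)"
    using assms(2,5) unfolding UW_relations_def by blast
  moreover have "rho i \<in> carrier G" "rho (i+1) \<in> carrier G" "sigma (i+1) t \<in> carrier G"
    using assms unfolding UW_relations_def by auto
  ultimately show ?thesis by (simp add: m_assoc)
qed

text \<open>When the rho agree, \<open>rho i\<close> times \<open>rho (Suc i)\<close> is a square,
  hence trivial, and the mixed relation makes consecutive sigma equal. Far commutation between the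
  indices 1 and 3 then covers all pairs of generators.\<close>

lemma UW_epi_comm_group:
  assumes "UW_epi G n c rho sigma" "5 \<le> n"
    and eq: "\<And>i. 1 \<le> i \<Longrightarrow> Suc i < n \<Longrightarrow> rho i = rho (Suc i)"
  shows "comm_group G"
proof -
  have G: "group G" and rel: "UW_relations G n c rho sigma"
    and gen: "generate G (rho ` {1..<n} \<union> (\<lambda>(i, t). sigma i t) ` ({1..<n} \<times> {1..c})) = carrier G"
    using assms(1) unfolding UW_epi_def by auto
  interpret group G by (rule G)
  have cl: "rho i \<in> carrier G" "rho i \<otimes>\<^bsub>G\<^esub> rho i = \<one>\<^bsub>G\<^esub>" if "1 \<le> i" "i < n" for i
    using rel that unfolding UW_relations_def by auto
  have cls: "sigma i t \<in> carrier G" if "1 \<le> i" "i < n" "t \<in> {1..c}" for i t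
    using rel that unfolding UW_relations_def by auto
  \<comment> \<open>Index 3 represents the common value because a defining relation makes
    \<open>sigma 1 t\<close> commute with \<open>rho 3\<close>.\<close>
  have rho: "rho i = rho 3" if "1 \<le> i" "i < n" for i
  proof -
    have "rho i = rho 1" if "1 \<le> i" "i < n" for i
      using that
    proof (induction i rule: dec_induct)
      case (step m)
      then show ?case using eq[of m] by simp
    qed simp
    from this[of i] this[of 3] show ?thesis using that assms(2) by simp
  qed
  have sigma_step: "sigma i t = sigma (Suc i) t" if "1 \<le> i" "Suc i < n" "t \<in> {1..c}" for i t
    using UW_sigma_step[OF G rel that] eq[of i] cl[of i] that cls[of i t] cls[of "Suc i" t]
    by simp
  have sigma: "sigma i t = sigma 1 t" if "1 \<le> i" "i < n" "t \<in> {1..c}" for i t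
    using that
  proof (induction i rule: dec_induct)
    case (step m)
    then show ?case using sigma_step[of m t] by simp
  qed simp
  have "sigma 1 t \<otimes>\<^bsub>G\<^esub> rho 3 = rho 3 \<otimes>\<^bsub>G\<^esub> sigma 1 t" if "t \<in> {1..c}" for t
    using rel that assms(2) unfolding UW_relations_def by auto
  moreover have "sigma 1 t \<otimes>\<^bsub>G\<^esub> sigma 1 l = sigma 1 l \<otimes>\<^bsub>G\<^esub> sigma 1 t"
    if "t \<in> {1..c}" "l \<in> {1..c}" for t l
  proof -
    have "sigma 1 t \<otimes>\<^bsub>G\<^esub> sigma 3 l = sigma 3 l \<otimes>\<^bsub>G\<^esub> sigma 1 t"
      using rel that assms(2) unfolding UW_relations_def by auto
    then show ?thesis using sigma[of 3 l] that assms(2) by simp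
  qed
  ultimately have comm: "x \<otimes>\<^bsub>G\<^esub> y = y \<otimes>\<^bsub>G\<^esub> x"
    if "x \<in> insert (rho 3) (sigma 1 ` {1..c})" "y \<in> insert (rho 3) (sigma 1 ` {1..c})" for x y
    using that by auto
  let ?gens = "rho ` {1..<n} \<union> (\<lambda>(i, t). sigma i t) ` ({1..<n} \<times> {1..c})"
  have sub: "?gens \<subseteq> insert (rho 3) (sigma 1 ` {1..c})"
  proof
    fix x assume "x \<in> ?gens"
    then consider i where "1 \<le> i" "i < n" "x = rho i"
      | i t where "1 \<le> i" "i < n" "t \<in> {1..c}" "x = sigma i t" by auto
    then show "x \<in> insert (rho 3) (sigma 1 ` {1..c})"
    proof cases
      case 1
      then show ?thesis using rho[of i] by blast
    next
      case 2
      then show ?thesis using sigma[of i t] by blast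
    qed
  qed
  show ?thesis
  proof (rule comm_group_generate[OF _ gen])
    show "?gens \<subseteq> carrier G" using cl(1) cls by auto
    show "x \<otimes>\<^bsub>G\<^esub> y = y \<otimes>\<^bsub>G\<^esub> x" if "x \<in> ?gens" "y \<in> ?gens" for x y
      by (rule comm; rule subsetD[OF sub]; rule that)
  qed
qed

section \<open>The images of the braid generators\<close>

text \<open>Conjugation by \<open>q\<close> fixes the transposition, hence preserves its
  support.\<close>

lemma commutes_with_transpose_imp:
  assumes "inj q" "q \<circ> transpose a b = transpose a b \<circ> q" "a \<noteq> b"
  shows "{q a, q b} = {a, b}"
proof -
  have "transpose (q a) (q b) \<circ> q = transpose a b \<circ> q"
    using conj_transpose[OF assms(1), of a b] assms(2) by simp
  then have "transpose (q a) (q b) (q a) = transpose a b (q a)"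
    by (metis comp_apply)
  moreover have "q a \<noteq> q b" using assms(1,3) by (auto simp: inj_eq)
  ultimately show ?thesis
    by (auto simp: transpose_def split: if_splits)
qed

text \<open>Each pair of neighbours from 3 on is preserved by \<open>q\<close>. A point strictly
  between 3 and \<open>n\<close> lies in two such pairs and is therefore fixed; then 3 and
  \<open>n\<close> are fixed as the partners of fixed points, and only 1 and 2 can move.\<close>

lemma centralizer_std_rho:
  assumes "5 \<le> n" "q permutes {1..n}"
    and comm: "\<And>j. 3 \<le> j \<Longrightarrow> j < n \<Longrightarrow> q \<circ> std_rho j = std_rho j \<circ> q"
  shows "q = id \<or> q = std_rho 1"
proof -
  note inj = permutes_inj[OF assms(2)]
  have pair: "{q j, q (Suc j)} = {j, Suc j}" if "3 \<le> j" "j < n" for j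
    using comm[OF that] commutes_with_transpose_imp[OF inj] by (simp add: std_rho_def)
  have mid: "q j = j" if "4 \<le> j" "j < n" for j
  proof -
    have "Suc (j - 1) = j" "3 \<le> j - 1" "j - 1 < n" using that by auto
    then have "{q (j - 1), q j} = {j - 1, j}" using pair[of "j - 1"] by simp
    then have "q j \<in> {j - 1, j}" by blast
    moreover have "{q j, q (Suc j)} = {j, Suc j}" using pair[of j] that by simp
    then have "q j \<in> {j, Suc j}" by blast
    ultimately show ?thesis using that by auto
  qed
  have "q 3 = 3"
    using pair[of 3] mid[of 4] assms(1) by (auto simp: doubleton_eq_iff)
  moreover have "q n = n"
  proof -
    have "Suc (n - 1) = n" "3 \<le> n - 1" "4 \<le> n - 1" "n - 1 < n" using assms(1) by auto
    then show ?thesis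
      using pair[of "n - 1"] mid[of "n - 1"] by (auto simp: doubleton_eq_iff)
  qed
  ultimately have fixed: "q j = j" if "3 \<le> j" "j \<le> n" for j
    using that mid[of j] by (cases "j = 3"; cases "j = n") auto
  have "q permutes {1, 2}"
  proof (rule permutes_superset[OF assms(2)])
    fix x assume "x \<in> {1..n} - {1, 2}"
    then show "q x = x" by (intro fixed) auto
  qed
  then show ?thesis
    by (auto simp: permutes_doubleton_iff std_rho_def numeral_2_eq_2)
qed

lemma sym_group_not_comm:
  assumes "3 \<le> n"
  shows "\<not> comm_group (sym_group n)"
proof
  assume "comm_group (sym_group n)"
  then interpret comm_group "sym_group n" .
  have "std_rho 1 \<circ> std_rho 2 = std_rho 2 \<circ> std_rho 1"
    using assms m_comm[of "std_rho 1" "std_rho 2"] std_rho_permutes[of 1 n] std_rho_permutes[of 2 n]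
    by (simp add: sym_group_carrier sym_group_mult)
  then have "(std_rho 1 \<circ> std_rho 2) 1 = (std_rho 2 \<circ> std_rho 1) 1" by simp
  then show False by (simp add: std_rho_def transpose_def)
qed

text \<open>If \<open>sigma 1 t\<close> were trivial, so would be its conjugate
  \<open>sigma 2 t\<close>, and the welded relation would collapse to \<open>rho 1 = rho 2\<close>.
  Once \<open>sigma 1 t\<close> is \<open>rho 1\<close>, both families satisfy the same conjugation
  recursion, the one for rho being the braid relation.\<close>

lemma UW_sigma_eq_rho:
  assumes "UW_epi G n c rho sigma" "3 \<le> n" "t \<in> {1..c}"
    and neq: "rho 1 \<noteq> rho 2"
    and first: "sigma 1 t = \<one>\<^bsub>G\<^esub> \<or> sigma 1 t = rho 1"
    and i: "1 \<le> i" "i < n"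
  shows "sigma i t = rho i"
proof -
  have G: "group G" and rel: "UW_relations G n c rho sigma"
    using assms(1) unfolding UW_epi_def by auto
  interpret group G by (rule G)
  have cl: "rho i \<in> carrier G" "sigma i t \<in> carrier G" if "1 \<le> i" "i < n" for i
    using rel that assms(3) unfolding UW_relations_def by auto
  have "sigma 1 t \<noteq> \<one>\<^bsub>G\<^esub>"
  proof
    assume 1: "sigma 1 t = \<one>\<^bsub>G\<^esub>"
    have cl': "rho 1 \<in> carrier G" "rho (Suc 1) \<in> carrier G" "sigma (Suc 1) t \<in> carrier G"
      using cl assms(2) by auto
    have 2: "rho 1 \<otimes>\<^bsub>G\<^esub> rho (Suc 1) =
        sigma (Suc 1) t \<otimes>\<^bsub>G\<^esub> (rho 1 \<otimes>\<^bsub>G\<^esub> rho (Suc 1))"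
      using UW_sigma_step[OF G rel _ _ assms(3), of 1] 1 cl' assms(2) by simp
    then have 2: "sigma (Suc 1) t = \<one>\<^bsub>G\<^esub>"
      using cl' by (metis m_closed r_cancel_one')
    have "1 \<in> {1..n-2}" using assms(2) by auto
    then have "rho 1 \<otimes>\<^bsub>G\<^esub> sigma (1+1) t \<otimes>\<^bsub>G\<^esub> sigma 1 t
          = sigma (1+1) t \<otimes>\<^bsub>G\<^esub> sigma 1 t \<otimes>\<^bsub>G\<^esub> rho (1+1)"
      using rel assms(3) unfolding UW_relations_def by blast
    then show False
      using 1 2 cl' neq by (simp add: numeral_2_eq_2)
  qed
  then have start: "sigma 1 t = rho 1" using first by simp
  show ?thesis using i
  proof (induction i rule: dec_induct)
    case base
    show ?case by (rule start)
  next
    case (step m)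
    then have cl': "rho m \<in> carrier G" "rho (Suc m) \<in> carrier G" "sigma (Suc m) t \<in> carrier G"
      and IH: "sigma m t = rho m"
      using cl by auto
    have "rho m \<otimes>\<^bsub>G\<^esub> rho (Suc m) \<otimes>\<^bsub>G\<^esub> rho m =
        rho (Suc m) \<otimes>\<^bsub>G\<^esub> rho m \<otimes>\<^bsub>G\<^esub> rho (Suc m)"
      using UW_relations_imp_coxeter[OF rel] step unfolding coxeter_relations_def by auto
    then have "sigma (Suc m) t \<otimes>\<^bsub>G\<^esub> (rho m \<otimes>\<^bsub>G\<^esub> rho (Suc m)) =
        rho (Suc m) \<otimes>\<^bsub>G\<^esub> (rho m \<otimes>\<^bsub>G\<^esub> rho (Suc m))"
      using UW_sigma_step[OF G rel _ _ assms(3), of m] step IH cl' by (simp add: m_assoc)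
    then show ?case using cl' by simp
  qed
qed

text \<open>A non-trivial kernel would identify all \<open>rho i\<close> and make \<open>G\<close>
  abelian. The bound by \<open>n!\<close> and the case of equality both rest on this
  embedding.\<close>

lemma UW_epi_embedding:
  assumes "UW_epi G n c rho sigma" "5 \<le> n" "\<not> comm_group G"
  obtains f where "f \<in> hom (sym_group n) G" "inj_on f (carrier (sym_group n))"
    "\<And>i. 1 \<le> i \<Longrightarrow> i < n \<Longrightarrow> f (std_rho i) = rho i"
proof -
  have G: "group G" and rel: "UW_relations G n c rho sigma"
    using assms(1) unfolding UW_epi_def by auto
  obtain f where f: "f \<in> hom (sym_group n) G" "\<And>i. 1 \<le> i \<Longrightarrow> i < n \<Longrightarrow> f (std_rho i) = rho i"
    using coxeter_hom[OF G UW_relations_imp_coxeter[OF rel]] by blast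
  interpret sym_group_hom n G f
    using G f(1) sym_group_is_group
    by (simp add: sym_group_hom_def group_hom_def group_hom_axioms_def)
  have "inj_on f (carrier (sym_group n))"
  proof (rule ccontr)
    assume "\<not> inj_on f (carrier (sym_group n))"
    then have "rho i = rho (Suc i)" if "1 \<le> i" "Suc i < n" for i
      using adjacent_images_eq[OF assms(2) _ that] f(2) that by simp
    then show False using UW_epi_comm_group[OF assms(1,2)] assms(3) by blast
  qed
  then show ?thesis using that f by blast
qed

lemma finite_sym_group: "finite (carrier (sym_group n))"
  using finite_permutations[of "{1..n}"] by (simp add: sym_group_def)

lemma inj_hom_sym_group_iso:
  assumes "f \<in> hom (sym_group n) G" "inj_on f (carrier (sym_group n))"
    and "finite (carrier G)" "card (carrier G) = fact n"
  shows "f \<in> iso (sym_group n) G"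
proof -
  have "f ` carrier (sym_group n) = carrier G"
  proof (rule card_subset_eq[OF assms(3)])
    show "f ` carrier (sym_group n) \<subseteq> carrier G"
      using assms(1) by (auto simp: hom_def)
    show "card (f ` carrier (sym_group n)) = card (carrier G)"
      using assms(2,4) by (simp add: card_image sym_group_card_carrier)
  qed
  then show ?thesis using assms(1,2) by (simp add: iso_def bij_betw_def)
qed

lemma UW_epi_sym_group:
  assumes "UW_epi (sym_group n) n c rho sigma" "5 \<le> n"
  obtains f where "f \<in> iso (sym_group n) (sym_group n)"
    "\<forall>i\<in>{1..<n}. rho i = f (std_rho i)"
    "\<forall>i\<in>{1..<n}. \<forall>t\<in>{1..c}. sigma i t = f (std_rho i)"
proof -
  let ?S = "sym_group n"
  interpret group ?S by (rule sym_group_is_group)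
  have rel: "UW_relations ?S n c rho sigma"
    using assms(1) unfolding UW_epi_def by auto
  obtain f where f: "f \<in> hom ?S ?S" "inj_on f (carrier ?S)"
    "\<And>i. 1 \<le> i \<Longrightarrow> i < n \<Longrightarrow> f (std_rho i) = rho i"
    using UW_epi_embedding[OF assms sym_group_not_comm] assms(2) by auto
  have iso: "f \<in> iso ?S ?S"
    by (rule inj_hom_sym_group_iso[OF f(1,2) finite_sym_group sym_group_card_carrier])
  have std: "std_rho i \<in> carrier ?S" if "1 \<le> i" "i < n" for i
    using that std_rho_permutes by (simp add: sym_group_carrier)
  have neq: "rho 1 \<noteq> rho 2"
  proof
    assume "rho 1 = rho 2"
    then have "std_rho 1 = std_rho 2"
      using f(3)[of 1] f(3)[of 2] inj_onD[OF f(2), of "std_rho 1" "std_rho 2"] std assms(2) by simp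
    then have "std_rho 1 1 = std_rho 2 1" by simp
    then show False by (simp add: std_rho_def transpose_def)
  qed
  have first: "sigma 1 t = \<one>\<^bsub>?S\<^esub> \<or> sigma 1 t = rho 1" if t: "t \<in> {1..c}" for t
  proof -
    have "sigma 1 t \<in> carrier ?S"
      using rel t assms(2) unfolding UW_relations_def by auto
    \<comment> \<open>Pulling \<open>sigma 1 t\<close> back along the automorphism reduces the
      question to the centralizer of standard generators.\<close>
    then have "sigma 1 t \<in> f ` carrier ?S"
      using iso by (simp add: iso_def bij_betw_def)
    then obtain q where q: "sigma 1 t = f q" "q \<in> carrier ?S" by (rule imageE)
    have "q \<circ> std_rho j = std_rho j \<circ> q" if "3 \<le> j" "j < n" for j
    proof -
      have j: "std_rho j \<in> carrier ?S" using std that by simp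
      have "sigma 1 t \<otimes>\<^bsub>?S\<^esub> rho j = rho j \<otimes>\<^bsub>?S\<^esub> sigma 1 t"
        using rel t that assms(2) unfolding UW_relations_def by auto
      then have "f (q \<otimes>\<^bsub>?S\<^esub> std_rho j) = f (std_rho j \<otimes>\<^bsub>?S\<^esub> q)"
        using q j f(3)[of j] that by (simp add: hom_mult[OF f(1)])
      then have "q \<otimes>\<^bsub>?S\<^esub> std_rho j = std_rho j \<otimes>\<^bsub>?S\<^esub> q"
        using q(2) j by (rule_tac inj_onD[OF f(2)]) auto
      then show ?thesis by (simp add: sym_group_mult)
    qed
    then have "q = id \<or> q = std_rho 1"
      using centralizer_std_rho[OF assms(2)] q(2) by (simp add: sym_group_carrier)
    moreover have "f id = \<one>\<^bsub>?S\<^esub>"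
      using hom_one[OF f(1) is_group is_group] by (simp add: sym_group_one)
    ultimately show ?thesis using q(1) f(3)[of 1] assms(2) by auto
  qed
  show ?thesis
  proof (rule that[OF iso])
    show "\<forall>i\<in>{1..<n}. rho i = f (std_rho i)" using f(3) by simp
    show "\<forall>i\<in>{1..<n}. \<forall>t\<in>{1..c}. sigma i t = f (std_rho i)"
      using UW_sigma_eq_rho[OF assms(1) _ _ neq first] assms(2) f(3) by simp
  qed
qed

section \<open>Automorphisms preserving transpositions are inner\<close>

lemma transpose_commute_disjoint:
  assumes "transpose a b \<circ> transpose c d = transpose c d \<circ> transpose a b"
    "transpose a b \<noteq> transpose c d" "c \<noteq> d" "a \<noteq> b"
  shows "{a, b} \<inter> {c, d} = {}"
proof (rule ccontr)
  assume "{a, b} \<inter> {c, d} \<noteq> {}"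
  \<comment> \<open>Distinct transpositions with a common point multiply to a 3-cycle, and reversing
    the order inverts it; the values at \<open>a\<close> and \<open>b\<close> show the
    difference.\<close>
  moreover have "transpose a b (transpose c d x) = transpose c d (transpose a b x)" for x
    using assms(1) by (metis comp_apply)
  note this[of a] this[of b]
  ultimately show False
    using assms(2-4) by (auto simp: transpose_def split: if_splits)
qed

lemma transpose_disjoint_commute:
  assumes "{a, b} \<inter> {c, d} = {}"
  shows "transpose a b \<circ> transpose c d = transpose c d \<circ> transpose a b"
  using assms by (auto simp: fun_eq_iff transpose_def)

text \<open>Transpositions with the commutation pattern of the standard generators form a chain:
  the sequence \<open>q\<close> of points is found by following the path from a suitable end point.\<close>

lemma transposition_chain:
  fixes r :: "nat \<Rightarrow> 'a \<Rightarrow> 'a"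
  assumes "2 \<le> m"
    and tr: "\<And>k. k < m \<Longrightarrow> \<exists>a b. a \<noteq> b \<and> r k = transpose a b"
    and braid: "\<And>k. Suc k < m \<Longrightarrow> r k \<circ> r (Suc k) \<noteq> r (Suc k) \<circ> r k"
    and far: "\<And>k l. Suc k < l \<Longrightarrow> l < m \<Longrightarrow> r k \<circ> r l = r l \<circ> r k \<and> r k \<noteq> r l"
  obtains q where "\<And>k. k < m \<Longrightarrow> r k = transpose (q k) (q (Suc k))" "inj_on q {..m}"
proof -
  have disj: False if "Suc k < l" "l < m" "r k x \<noteq> x" "r l x \<noteq> x" for k l x
  proof -
    have "k < m" using that by simp
    note tr_kl = tr[OF this] tr[OF that(2)]
    obtain a b c d
      where ab: "a \<noteq> b" "r k = transpose a b" and cd: "c \<noteq> d" "r l = transpose c d"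
      using tr_kl by blast
    have "{a, b} \<inter> {c, d} = {}"
      using far[OF that(1,2)] ab cd by (intro transpose_commute_disjoint) auto
    then show False using that(3,4) ab cd by (auto simp: transpose_def split: if_splits)
  qed
  have moved: "r k = transpose x (r k x)" if "k < m" "r k x \<noteq> x" for k x
  proof -
    note tr_k = tr[OF that(1)]
    obtain a b where ab: "r k = transpose a b" using tr_k by blast
    then have "x = a \<or> x = b" using that(2) by (auto simp: transpose_def split: if_splits)
    then show ?thesis using ab by (auto simp: transpose_commute)
  qed
  have touch: "\<not> (r (Suc k) x = x \<and> r (Suc k) (r k x) = r k x)"
    if "Suc k < m" "r k x \<noteq> x" for k x
  proof
    assume fixed: "r (Suc k) x = x \<and> r (Suc k) (r k x) = r k x"
    note tr_k = tr[OF that(1)]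
    obtain c d where cd: "c \<noteq> d" "r (Suc k) = transpose c d"
      using tr_k by blast
    then have "{x, r k x} \<inter> {c, d} = {}"
      using fixed by (auto simp: transpose_def split: if_splits)
    then have "r k \<circ> r (Suc k) = r (Suc k) \<circ> r k"
      using transpose_disjoint_commute[of x "r k x" c d] moved[of k x] that cd by auto
    then show False using braid[OF that(1)] by simp
  qed
  \<comment> \<open>The free end of the path: \<open>r 0\<close> and \<open>r 1\<close> differ, so
    one of the two points moved by \<open>r 0\<close> is fixed by \<open>r 1\<close>.\<close>
  obtain a where a: "r 0 a \<noteq> a" "r 1 a = a"
  proof -
    obtain x y where xy: "x \<noteq> y" "r 0 = transpose x y" using tr[of 0] assms(1) by auto
    obtain z w where zw: "z \<noteq> w" "r 1 = transpose z w" using tr[of 1] assms(1) by auto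
    have "r 0 \<noteq> r 1" using braid[of 0] assms(1) by auto
    then have "r 1 x = x \<or> r 1 y = y"
      using xy zw by (auto simp: transpose_def fun_eq_iff split: if_splits)
    then show ?thesis using that[of x] that[of y] xy by auto
  qed
  \<comment> \<open>Each transposition is applied to the current point and yields the next
    one.\<close>
  define q where "q = rec_nat a r"
  have q: "q 0 = a" "q (Suc k) = r k (q k)" for k by (simp_all add: q_def)
  \<comment> \<open>Invariant: \<open>q k\<close> is the end of \<open>r k\<close> that
    \<open>r (Suc k)\<close> does not touch. By \<open>touch\<close> the other end
    \<open>q (Suc k)\<close> is moved by \<open>r (Suc k)\<close>, and by \<open>disj\<close> it
    cannot be moved by the transposition after that, as \<open>r k\<close> moves it.\<close>
  have inv: "k < m \<Longrightarrow> r k (q k) \<noteq> q k \<and> (Suc k < m \<longrightarrow> r (Suc k) (q k) = q k)" for k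
  proof (induction k)
    case 0
    then show ?case using a q by simp
  next
    case (Suc k)
    then have IH: "r k (q k) \<noteq> q k" "r (Suc k) (q k) = q k" by auto
    then have "r (Suc k) (q (Suc k)) \<noteq> q (Suc k)"
      using touch[OF Suc.prems IH(1)] q(2) by auto
    moreover have "r k (q (Suc k)) \<noteq> q (Suc k)"
    proof -
      have "r k = transpose (q k) (r k (q k))" using moved IH(1) Suc.prems by auto
      then have "r k (q (Suc k)) = q k" using q(2) by (metis transpose_apply_second)
      then show ?thesis using IH(1) q(2) by auto
    qed
    ultimately show ?case using disj[of k "Suc (Suc k)" "q (Suc k)"] by auto
  qed
  have r: "r k = transpose (q k) (q (Suc k))" if "k < m" for k
    using moved[OF that] inv[OF that] q(2) by simp
  have step: "q k \<noteq> q (Suc k)" if "k < m" for k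
    using inv[OF that] q(2)[of k] by metis
  \<comment> \<open>A repeated point would be moved by both \<open>r i\<close> and
    \<open>r (j - 1)\<close>. This contradicts \<open>disj\<close> for distant indices, the
    invariant for neighbours, and \<open>step\<close> when the indices agree.\<close>
  have neq: "q i \<noteq> q j" if "i < j" "j \<le> m" for i j
  proof
    assume eq: "q i = q j"
    have "j \<noteq> 0" using that by simp
    then obtain j' where j: "j = Suc j'" by (metis not0_implies_Suc)
    have mi: "r i (q i) \<noteq> q i" and mj: "r j' (q j) \<noteq> q j"
      using inv[of i] r[of j'] step[of j'] that j by auto
    have "i \<le> j'" using that j by simp
    then consider "j' = i" | "j' = Suc i" | "Suc i < j'" by linarith
    then show False
    proof cases
      case 1
      then show ?thesis using step[of i] eq j that by simp
    next
      case 2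
      then show ?thesis using inv[of i] mj eq j that by simp
    next
      case 3
      then show ?thesis using disj[of i j' "q i"] mi mj eq j that by simp
    qed
  qed
  have "inj_on q {..m}"
  proof (rule inj_onI)
    fix i j assume "i \<in> {..m}" "j \<in> {..m}" "q i = q j"
    then show "i = j" using neq[of i j] neq[of j i] by (cases i j rule: linorder_cases) auto
  qed
  then show ?thesis using that r by blast
qed

text \<open>If \<open>x\<close> moves two pairs of points, its product with a suitable conjugate has a cycle of
  length 5 (using a fixed point of \<open>x\<close>) or of length 4 (using four pairs); for \<open>n \<ge> 5\<close>, only
  the product of three transpositions on six points escapes.\<close>

lemma involution_is_transpose:
  fixes n :: nat
  assumes "5 \<le> n" "n \<noteq> 6" "x permutes {1..n}" "x \<noteq> id"
    and invol: "\<And>u. x (x u) = u"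
    and order: "\<And>g y. g permutes {1..n} \<Longrightarrow> y \<circ> g = g \<circ> x \<Longrightarrow>
      ((x \<circ> y) ^^ 2 = id \<or> (x \<circ> y) ^^ 3 = id)"
  shows "\<exists>a b. a \<noteq> b \<and> x = transpose a b"
proof -
  have in_iff: "x u \<in> {1..n} \<longleftrightarrow> u \<in> {1..n}" for u
    using permutes_in_image[OF assms(3)] .
  \<comment> \<open>The equation says that \<open>y\<close> is the conjugate of \<open>x\<close> by
    \<open>g\<close>, and gives its values without inverting \<open>g\<close>.\<close>
  have conj: "\<exists>y. y \<circ> g = g \<circ> x" if "g permutes {1..n}" for g
    using that by (intro exI[of _ "g \<circ> x \<circ> inv' g"]) (simp add: comp_assoc permutes_inv_o)
  obtain a where a: "x a \<noteq> a" using assms(4) by (auto simp: fun_eq_iff)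
  then have an: "a \<in> {1..n}" using permutes_not_in[OF assms(3)] by blast
  show ?thesis
  proof (cases "\<exists>c. c \<notin> {a, x a} \<and> x c \<noteq> c")
    case False
    have "x u = transpose a (x a) u" for u
      using False invol[of a] unfolding transpose_def by auto
    then have "x = transpose a (x a)" by (rule ext)
    then show ?thesis using a by metis
  next
    case True
    then obtain c where c: "c \<notin> {a, x a}" "x c \<noteq> c" by blast
    then have cn: "c \<in> {1..n}" using permutes_not_in[OF assms(3)] by blast
    have xc: "x c \<noteq> a" "x c \<noteq> x a" using c(1) invol[of a] invol[of c] by auto
    have no_fix: "x u \<noteq> u" if u: "u \<in> {1..n}" for u
    proof
      assume fixed: "x u = u"
      then have u_neq: "u \<noteq> a" "u \<noteq> c" "u \<noteq> x a" "u \<noteq> x c"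
        using a c invol by metis+
      \<comment> \<open>The conjugate \<open>y\<close> swaps \<open>x a\<close> with
        \<open>c\<close> and \<open>x c\<close> with \<open>u\<close> and fixes \<open>a\<close>,
        the default value being that at \<open>u\<close>. Then \<open>x \<circ> y\<close> contains
        the 5-cycle \<open>a\<close>, \<open>x a\<close>, \<open>x c\<close>, \<open>u\<close>,
        \<open>c\<close>.\<close>
      define g where "g = (\<lambda>_. a)(a := x a, x a := c, c := x c, x c := u)"
      have 1: "{a, x a, c, x c, u} \<subseteq> {1..n}" using an cn u in_iff by blast
      have 2: "g ` {a, x a, c, x c, u} \<subseteq> {1..n}"
        using an cn u in_iff[of a] in_iff[of c] by (auto simp: g_def)
      have 3: "inj_on g {a, x a, c, x c, u}"
        using a c u_neq xc by (auto simp: g_def inj_on_def)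
      obtain p where p: "p permutes {1..n}" "\<And>z. z \<in> {a, x a, c, x c, u} \<Longrightarrow> p z = g z"
        using permutes_extends[OF finite_atLeastAtMost 1 2 3] by metis
      have pv: "p a = x a" "p (x a) = c" "p c = x c" "p (x c) = u" "p u = a"
        using p(2) a c u_neq xc by (auto simp: g_def)
      obtain y where y: "y \<circ> p = p \<circ> x" using conj[OF p(1)] by blast
      then have "y (p z) = p (x z)" for z by (metis comp_apply)
      note this[of a] this[of "x a"] this[of c] this[of "x c"] this[of u]
      then have yv: "y (x a) = c" "y c = x a" "y (x c) = u" "y u = x c" "y a = a"
        using pv fixed by (simp_all add: invol)
      have "((x \<circ> y) ^^ 2) a = x c" "((x \<circ> y) ^^ 3) a = u"
        using yv fixed by (simp_all add: eval_nat_numeral)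
      then show False
        using order[OF p(1) y] xc(1) u_neq(1) by (auto simp del: funpow.simps)
    qed
    \<comment> \<open>Without fixed points there is a third pair; the six points so found and
      \<open>n \<noteq> 6\<close> then leave room for a fourth.\<close>
    obtain d where d: "d \<in> {1..n}" "d \<notin> set [a, x a, c, x c]"
      using assms(1) by (rule_tac ex_fresh[of "[a, x a, c, x c]" n]) auto
    have xd: "x d \<noteq> d" "x d \<noteq> a" "x d \<noteq> x a" "x d \<noteq> c" "x d \<noteq> x c"
      using d(2) no_fix[OF d(1)] invol[of a] invol[of c] invol[of d] by auto
    have "card (set [a, x a, c, x c, d, x d]) = 6"
      using a c d xc xd by auto
    moreover have "set [a, x a, c, x c, d, x d] \<subseteq> {1..n}"
      using an cn d in_iff by auto
    ultimately have "6 < n"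
      using card_mono[of "{1..n}" "set [a, x a, c, x c, d, x d]"] assms(2) by simp
    then obtain e where e: "e \<in> {1..n}" "e \<notin> set [a, x a, c, x c, d, x d]"
      by (rule_tac ex_fresh[of "[a, x a, c, x c, d, x d]" n]) auto
    have xe: "x e \<noteq> e" "x e \<noteq> a" "x e \<noteq> x a" "x e \<noteq> c" "x e \<noteq> x c" "x e \<noteq> d" "x e \<noteq> x d"
      using e(2) no_fix[OF e(1)] invol[of a] invol[of c] invol[of d] invol[of e] by auto
    let ?A = "{a, x a, c, x c, d, x d, e, x e}"
    \<comment> \<open>A rotation of the eight points by one place, the default value closing the
      cycle at \<open>x e\<close>. The pairs of \<open>y\<close> interleave with those of
      \<open>x\<close> around an octagon, so \<open>x \<circ> y\<close> contains the 4-cycle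
      \<open>a\<close>, \<open>e\<close>, \<open>d\<close>, \<open>c\<close>.\<close>
    define g where "g = (\<lambda>_. a)
      (a := x a, x a := c, c := x c, x c := d, d := x d, x d := e, e := x e)"
    note neqs = a c xc d xd e xe
    have gv: "g a = x a" "g (x a) = c" "g c = x c" "g (x c) = d" "g d = x d" "g (x d) = e"
      "g e = x e" "g (x e) = a"
      using neqs by (auto simp: g_def)
    have img: "g ` ?A = ?A" using gv by auto
    then have "inj_on g ?A" by (intro eq_card_imp_inj_on) auto
    moreover have A: "?A \<subseteq> {1..n}" using an cn d(1) e(1) in_iff by blast
    moreover have "g ` ?A \<subseteq> {1..n}" unfolding img by (rule A)
    ultimately obtain p where p: "p permutes {1..n}" "\<And>z. z \<in> ?A \<Longrightarrow> p z = g z"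
      using permutes_extends[OF finite_atLeastAtMost, of ?A 1 n g] by metis
    have pv: "p a = x a" "p (x a) = c" "p c = x c" "p (x c) = d" "p d = x d" "p (x d) = e"
      "p e = x e" "p (x e) = a"
      using p(2) gv by auto
    obtain y where y: "y \<circ> p = p \<circ> x" using conj[OF p(1)] by blast
    then have "y (p z) = p (x z)" for z by (metis comp_apply)
    note this[of a] this[of "x a"] this[of c] this[of "x c"] this[of d] this[of "x d"]
      this[of e] this[of "x e"]
    then have yv: "y (x a) = c" "y c = x a" "y (x c) = d" "y d = x c" "y (x d) = e"
      "y e = x d" "y (x e) = a" "y a = x e"
      using pv by (simp_all add: invol)
    have "((x \<circ> y) ^^ 2) a = d" "((x \<circ> y) ^^ 3) a = c"
      using yv by (simp_all add: eval_nat_numeral invol)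
    then show ?thesis
      using order[OF p(1) y] d c by (auto simp del: funpow.simps)
  qed
qed

text \<open>With no, one or two points in common, the product is an involution, a 3-cycle or the
  identity.\<close>

lemma transpose_mult_order:
  assumes "a \<noteq> b" "c \<noteq> d"
  shows "(transpose a b \<circ> transpose c d) ^^ 2 = id \<or> (transpose a b \<circ> transpose c d) ^^ 3 = id"
proof (cases "{a, b} \<inter> {c, d} = {}")
  case True
  then show ?thesis by (auto simp: fun_eq_iff transpose_def eval_nat_numeral)
next
  case False
  then have "b = c \<and> a \<noteq> d \<or> b = d \<and> a \<noteq> c \<or> a = c \<and> b \<noteq> d \<or> a = d \<and> b \<noteq> c
      \<or> transpose a b = transpose c d"
    by (auto simp: transpose_commute)
  then show ?thesis
    using assms by (elim disjE) (auto simp: fun_eq_iff transpose_def eval_nat_numeral)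
qed

lemma hom_funpow:
  assumes "f \<in> hom (sym_group n) (sym_group n)" "u \<in> carrier (sym_group n)"
  shows "u ^^ k \<in> carrier (sym_group n) \<and> f (u ^^ k) = f u ^^ k"
proof (induction k)
  case 0
  have "f id = id"
    using hom_one[OF assms(1) sym_group_is_group sym_group_is_group] by (simp add: sym_group_one)
  then show ?case
    unfolding funpow.simps(1) sym_group_carrier using permutes_id by blast
next
  case (Suc k)
  then have "u \<circ> u ^^ k \<in> carrier (sym_group n)"
    using assms(2) by (simp add: sym_group_carrier permutes_compose)
  moreover have "f (u \<circ> u ^^ k) = f u \<circ> f (u ^^ k)"
    using hom_mult[OF assms(1), of u "u ^^ k"] assms(2) Suc by (simp add: sym_group_mult)
  ultimately show ?case using Suc by (simp only: funpow.simps)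
qed

text \<open>By surjectivity every conjugate of the image of a transposition is the image of a
  conjugate transposition, and \<open>f\<close> carries over the identities for powers of the
  products.\<close>

lemma iso_transpose:
  assumes iso: "f \<in> iso (sym_group n) (sym_group n)"
    and n: "5 \<le> n" "n \<noteq> 6"
    and ab: "a \<in> {1..n}" "b \<in> {1..n}" "a \<noteq> b"
  shows "\<exists>c d. c \<noteq> d \<and> f (transpose a b) = transpose c d"
proof -
  let ?S = "sym_group n" and ?t = "transpose a b"
  have f: "f \<in> hom ?S ?S" and inj: "inj_on f (carrier ?S)" and surj: "f ` carrier ?S = carrier ?S"
    using iso by (auto simp: iso_def bij_betw_def)
  have t: "?t \<in> carrier ?S" using ab by (intro transpose_in_sym_group)
  have mult: "f (u \<circ> v) = f u \<circ> f v" if "u \<in> carrier ?S" "v \<in> carrier ?S" for u v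
    using hom_mult[OF f that] by (simp add: sym_group_mult)
  have f_id: "f id = id"
    using hom_one[OF f sym_group_is_group sym_group_is_group] by (simp add: sym_group_one)
  have id_S: "id \<in> carrier ?S" by (simp add: sym_group_carrier permutes_id)
  have ft: "f ?t \<in> carrier ?S" using hom_in_carrier[OF f t] .
  show ?thesis
  proof (rule involution_is_transpose[OF n])
    show "f ?t permutes {1..n}" using ft by (simp add: sym_group_carrier)
    show "f ?t \<noteq> id"
    proof
      assume "f ?t = id"
      then have "?t = id" using inj_onD[OF inj _ t id_S] f_id by simp
      then show False using ab(3) by (simp add: transpose_eq_id_iff)
    qed
    show "f ?t (f ?t u) = u" for u
    proof -
      have "f ?t \<circ> f ?t = id" using mult[OF t t] f_id by simp
      then show ?thesis by (metis comp_apply id_apply)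
    qed
    fix g y assume g: "g permutes {1..n}" and y: "y \<circ> g = g \<circ> f ?t"
    have "g \<in> f ` carrier ?S" using g surj by (simp add: sym_group_carrier)
    then obtain h where h: "g = f h" "h \<in> carrier ?S" by (rule imageE)
    then have hp: "h permutes {1..n}" by (simp add: sym_group_carrier)
    let ?t' = "transpose (h a) (h b)"
    have t': "?t' \<in> carrier ?S"
      using ab permutes_in_image[OF hp] by (intro transpose_in_sym_group) auto
    have "f ?t' \<circ> g = g \<circ> f ?t"
      using mult[OF t' h(2)] mult[OF h(2) t] conj_transpose[OF permutes_inj[OF hp], of a b] h(1)
      by simp
    then have "y \<circ> g \<circ> inv' g = f ?t' \<circ> g \<circ> inv' g" using y by simp
    then have y_eq: "y = f ?t'" by (simp add: comp_assoc permutes_inv_o[OF g])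
    have tt': "?t \<circ> ?t' \<in> carrier ?S"
      using t t' by (simp add: sym_group_carrier permutes_compose)
    have pow: "(f ?t \<circ> y) ^^ k = f ((?t \<circ> ?t') ^^ k)" for k
      unfolding y_eq mult[OF t t', symmetric] using hom_funpow[OF f tt'] by simp
    have "h a \<noteq> h b" using ab(3) permutes_inj[OF hp] by (simp add: inj_eq)
    then show "(f ?t \<circ> y) ^^ 2 = id \<or> (f ?t \<circ> y) ^^ 3 = id"
      unfolding pow using transpose_mult_order[OF ab(3), of "h a" "h b"] f_id by auto
  qed
qed

text \<open>The images of the standard generators are transpositions with the same commutation
  pattern, hence form a path; listing its points in order is the conjugating permutation.\<close>

lemma sym_group_iso_inner:
  assumes iso: "f \<in> iso (sym_group n) (sym_group n)" and n: "5 \<le> n" "n \<noteq> 6"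
  shows "\<exists>p\<in>carrier (sym_group n).
    \<forall>i\<in>{1..<n}. f (std_rho i) = conj_by (sym_group n) p (std_rho i)"
proof -
  let ?S = "sym_group n"
  have f: "f \<in> hom ?S ?S" and inj: "inj_on f (carrier ?S)"
    using iso by (auto simp: iso_def bij_betw_def)
  have std: "std_rho i \<in> carrier ?S" if "1 \<le> i" "i < n" for i
    using std_rho_permutes that by (simp add: sym_group_carrier)
  \<comment> \<open>Indices are shifted to start at 0, as the chain does; \<open>m\<close>
    transpositions pass through the \<open>n\<close> points \<open>q 0\<close> to
    \<open>q m\<close>.\<close>
  define r where "r k = f (std_rho (Suc k))" for k
  define m where "m = n - 1"
  have rp: "r k permutes {1..n}" if "k < m" for k
    using hom_in_carrier[OF f std] that by (simp add: r_def m_def sym_group_carrier)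
  have r_comp: "r k \<circ> r l = f (std_rho (Suc k) \<circ> std_rho (Suc l))" if "k < m" "l < m" for k l
    using hom_mult[OF f std std, of "Suc k" "Suc l"] that by (simp add: r_def m_def sym_group_mult)
  have std_comp: "std_rho (Suc k) \<circ> std_rho (Suc l) \<in> carrier ?S" if "k < m" "l < m" for k l
    using std_rho_permutes[of "Suc k" n] std_rho_permutes[of "Suc l" n] that
    by (simp add: m_def sym_group_carrier permutes_compose)
  have m: "2 \<le> m" using n by (simp add: m_def)
  have r_transpose: "\<exists>a b. a \<noteq> b \<and> r k = transpose a b" if "k < m" for k
    using iso_transpose[OF iso n, of "Suc k" "Suc (Suc k)"] that
    by (auto simp: r_def m_def std_rho_def)
  have r_braid: "r k \<circ> r (Suc k) \<noteq> r (Suc k) \<circ> r k" if "Suc k < m" for k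
  proof
    assume "r k \<circ> r (Suc k) = r (Suc k) \<circ> r k"
    then have eq: "std_rho (Suc k) \<circ> std_rho (Suc (Suc k)) = std_rho (Suc (Suc k)) \<circ> std_rho (Suc k)"
      using that r_comp[of k "Suc k"] r_comp[of "Suc k" k]
        inj_onD[OF inj _ std_comp std_comp, of k "Suc k" "Suc k" k] by simp
    show False
      using fun_cong[OF eq, of "Suc k"] by (simp add: std_rho_def transpose_def)
  qed
  have r_far: "r k \<circ> r l = r l \<circ> r k \<and> r k \<noteq> r l" if "Suc k < l" "l < m" for k l
  proof
    have "std_rho (Suc k) \<circ> std_rho (Suc l) = std_rho (Suc l) \<circ> std_rho (Suc k)"
      unfolding std_rho_def using that by (intro transpose_disjoint_commute) auto
    then show "r k \<circ> r l = r l \<circ> r k" using r_comp that by simp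
    show "r k \<noteq> r l"
    proof
      assume "r k = r l"
      then have eq: "std_rho (Suc k) = std_rho (Suc l)"
        using inj_onD[OF inj _ std std, of "Suc k" "Suc l"] that by (simp add: r_def m_def)
      show False
        using fun_cong[OF eq, of "Suc k"] that by (simp add: std_rho_def transpose_def)
    qed
  qed
  obtain q
    where q: "\<And>k. k < m \<Longrightarrow> r k = transpose (q k) (q (Suc k))" and inj_q: "inj_on q {..m}"
    using transposition_chain[where r = r, OF m r_transpose r_braid r_far] by metis
  have q_neq: "q k \<noteq> q (Suc k)" if "k < m" for k
    using inj_onD[OF inj_q, of k "Suc k"] that by auto
  \<comment> \<open>Every point of the path is moved by some \<open>r l\<close>; the last point has
    no \<open>r m\<close> and uses \<open>r (m - 1)\<close>.\<close>
  have q_mem: "q k \<in> {1..n}" if "k \<le> m" for k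
  proof -
    obtain l where "l < m" "r l (q k) \<noteq> q k"
    proof (cases "k = m")
      case True
      then have "m - 1 < m" "Suc (m - 1) = k" using m by auto
      then show ?thesis using q[of "m - 1"] q_neq[of "m - 1"] that[of "m - 1"] by simp
    next
      case False
      then have "k < m" using \<open>k \<le> m\<close> by simp
      then show ?thesis using q[of k] q_neq[of k] that[of k] by simp
    qed
    then show ?thesis using permutes_not_in[OF rp] by blast
  qed
  let ?g = "\<lambda>i. q (i - 1)"
  have g: "?g ` {1..n} \<subseteq> {1..n}"
  proof (rule image_subsetI)
    fix i assume "i \<in> {1..n}"
    then show "?g i \<in> {1..n}" by (intro q_mem) (auto simp: m_def)
  qed
  have inj_g: "inj_on ?g {1..n}"
  proof (rule inj_onI)
    fix i j assume ij: "i \<in> {1..n}" "j \<in> {1..n}" "?g i = ?g j"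
    then have "i - 1 \<in> {..m}" "j - 1 \<in> {..m}" by (auto simp: m_def)
    then have "i - 1 = j - 1" using inj_onD[OF inj_q ij(3)] by blast
    then show "i = j" using ij by auto
  qed
  obtain p where p: "p permutes {1..n}" "\<And>i. i \<in> {1..n} \<Longrightarrow> p i = ?g i"
    using permutes_extends[OF finite_atLeastAtMost order_refl g inj_g] by metis
  have pS: "p \<in> carrier ?S" using p(1) by (simp add: sym_group_carrier)
  have "f (std_rho i) = conj_by ?S p (std_rho i)" if "i \<in> {1..<n}" for i
  proof -
    have i: "i - 1 < m" "Suc (i - 1) = i" using that by (auto simp: m_def)
    have "p i = q (i - 1)" "p (Suc i) = q i" using p(2)[of i] p(2)[of "Suc i"] that by auto
    then have "conj_by ?S p (std_rho i) = transpose (q (i - 1)) (q i)"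
      unfolding std_rho_def conj_by_transpose[OF pS] by simp
    also have "\<dots> = r (i - 1)" using q[OF i(1)] i(2) by simp
    finally show ?thesis using i(2) by (simp add: r_def)
  qed
  then show ?thesis using pS by blast
qed

section \<open>The exceptional automorphism\<close>

text \<open>Two products of three disjoint transpositions on six points commute if they share a
  transposition, and satisfy the braid relation if they share none; the five products are
  chosen so that exactly the consecutive ones share none.\<close>

definition syntheme :: "nat \<Rightarrow> nat \<Rightarrow> nat" where
  "syntheme i =
     (if i = 1 then transpose 1 2 \<circ> transpose 3 4 \<circ> transpose 5 6
      else if i = 2 then transpose 1 3 \<circ> transpose 2 5 \<circ> transpose 4 6
      else if i = 3 then transpose 1 2 \<circ> transpose 3 6 \<circ> transpose 4 5
      else if i = 4 then transpose 1 3 \<circ> transpose 2 4 \<circ> transpose 5 6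
      else transpose 1 2 \<circ> transpose 3 5 \<circ> transpose 4 6)"

text \<open>Turns identities between products of synthemes into evaluation at six points.\<close>

lemma six_points: "f = g" if "\<And>x. x \<notin> {1, 2, 3, 4, 5, 6} \<Longrightarrow> f x = g x"
  "f 1 = g 1" "f 2 = g 2" "f 3 = g 3" "f 4 = g 4" "f 5 = g 5" "f 6 = g 6" for f g :: "nat \<Rightarrow> nat"
proof
  fix x
  show "f x = g x"
  proof (cases "x \<in> {1, 2, 3, 4, 5, 6}")
    case True
    then show ?thesis using that(2-) by (elim insertE) auto
  qed (rule that(1))
qed

lemma syntheme_coxeter: "coxeter_relations (sym_group 6) 6 syntheme"
proof -
  have perm: "syntheme i permutes {1..6}" for i
    unfolding syntheme_def by (simp add: permutes_compose permutes_swap_id)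
  have square: "syntheme i \<circ> syntheme i = id" for i
    unfolding syntheme_def by (rule six_points) (simp_all add: transpose_def)
  have braid: "syntheme i \<circ> syntheme (Suc i) \<circ> syntheme i =
      syntheme (Suc i) \<circ> syntheme i \<circ> syntheme (Suc i)" if "i \<in> {1, 2, 3, 4}" for i
    using that unfolding syntheme_def
    by (elim insertE) (rule six_points; simp add: transpose_def)+
  have far: "syntheme i \<circ> syntheme j = syntheme j \<circ> syntheme i"
    if "(i, j) \<in> {(1, 3), (1, 4), (1, 5), (2, 4), (2, 5), (3, 5)}" for i j
    using that unfolding syntheme_def
    by (elim insertE) (rule six_points; simp add: transpose_def)+
  show ?thesis
    unfolding coxeter_relations_def sym_group_carrier sym_group_mult sym_group_one
  proof (intro conjI allI impI)
    fix i :: nat assume "1 \<le> i \<and> Suc i < 6"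
    then have "i \<in> {1, 2, 3, 4}" by auto
    then show "syntheme i \<circ> syntheme (Suc i) \<circ> syntheme i =
      syntheme (Suc i) \<circ> syntheme i \<circ> syntheme (Suc i)" by (rule braid)
  next
    fix i j :: nat assume "1 \<le> i \<and> Suc i < j \<and> j < 6"
    then have "(i, j) \<in> {(1, 3), (1, 4), (1, 5), (2, 4), (2, 5), (3, 5)}" by auto
    then show "syntheme i \<circ> syntheme j = syntheme j \<circ> syntheme i" by (rule far)
  qed (use perm square in auto)
qed

text \<open>The homomorphism given by the synthemes is injective, as the first two differ, and it
  sends a transposition to a product of three disjoint ones, which is not conjugate to a
  transposition.\<close>

lemma sym_group_6_outer:
  "\<exists>f\<in>iso (sym_group 6) (sym_group 6).
     \<not> (\<exists>p\<in>carrier (sym_group 6). f (std_rho 1) = conj_by (sym_group 6) p (std_rho 1))"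
proof -
  obtain f where f: "f \<in> hom (sym_group 6) (sym_group 6)"
    "\<And>i. 1 \<le> i \<Longrightarrow> i < 6 \<Longrightarrow> f (std_rho i) = syntheme i"
    using coxeter_hom[OF sym_group_is_group syntheme_coxeter] by blast
  interpret sym_group_hom 6 "sym_group 6" f
    using f(1) sym_group_is_group
    by (simp add: sym_group_hom_def group_hom_def group_hom_axioms_def)
  have "inj_on f (carrier (sym_group 6))"
  proof (rule ccontr)
    assume "\<not> inj_on f (carrier (sym_group 6))"
    then have "syntheme 1 = syntheme (Suc 1)"
      using adjacent_images_eq[of 1] f(2)[of 1] f(2)[of "Suc 1"] by simp
    then have "syntheme 1 1 = syntheme (Suc 1) 1" by simp
    then show False by (simp add: syntheme_def transpose_def)
  qed
  then have iso: "f \<in> iso (sym_group 6) (sym_group 6)"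
    by (rule inj_hom_sym_group_iso[OF f(1) _ finite_sym_group sym_group_card_carrier])
  have "f (std_rho 1) \<noteq> conj_by (sym_group 6) p (std_rho 1)" if "p \<in> carrier (sym_group 6)" for p
  proof
    assume "f (std_rho 1) = conj_by (sym_group 6) p (std_rho 1)"
    then have eq: "syntheme 1 = transpose (p 1) (p 2)"
      using conj_by_transpose[OF that] f(2)[of 1] by (simp add: std_rho_def numeral_2_eq_2)
    \<comment> \<open>A single transposition cannot move both 1 to 2 and 3 to 4.\<close>
    have "transpose (p 1) (p 2) 1 = 2" "transpose (p 1) (p 2) 3 = 4"
      unfolding eq[symmetric] by (simp_all add: syntheme_def transpose_def)
    then show False by (auto simp: transpose_eq_iff)
  qed
  then show ?thesis using iso by blast
qed

section \<open>The symmetric group as a quotient, and the classification\<close>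

lemma UW_quotient_sym_group: "UW_quotient (sym_group n) n c"
proof -
  \<comment> \<open>With rho and sigma sent to the same adjacent transposition, the mixed and the
    welded relations both become the braid relation.\<close>
  have cox: "UW_relations (sym_group n) n c std_rho std_sigma"
    unfolding UW_relations_def sym_group_carrier sym_group_mult sym_group_one std_rho_def std_sigma_def
    by (auto intro!: permutes_swap_id transpose_disjoint_commute)
       (auto simp: fun_eq_iff transpose_def)
  have gens: "std_rho ` {1..<n} \<union> (\<lambda>(i, t). std_sigma i t) ` ({1..<n} \<times> {1..c}) = std_rho ` {1..<n}"
    by (auto simp: std_rho_def std_sigma_def)
  show ?thesis
    unfolding UW_quotient_def UW_epi_def
    by (intro exI conjI) (rule sym_group_is_group cox, rule cox, unfold gens, rule generate_std_rho)
qed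

theorem theorem5p12:
  fixes n c :: nat
  assumes "n \<ge> 5" and "c \<ge> 1"
  shows
    "UW_quotient (sym_group n) n c
     \<and> (\<forall>G :: ('g, 'b) monoid_scheme.
          group G \<and> finite (carrier G) \<and> \<not> comm_group G \<and> UW_quotient G n c \<longrightarrow>
            fact n \<le> card (carrier G) \<and>
            (card (carrier G) = fact n \<longrightarrow> G \<cong> sym_group n))
     \<and> (\<forall>rho sigma. UW_epi (sym_group n) n c rho sigma \<longrightarrow>
          (\<exists>\<alpha> \<in> iso (sym_group n) (sym_group n).
             (\<forall>i\<in>{1..<n}. rho i = \<alpha> (std_rho i)) \<and>
             (\<forall>i\<in>{1..<n}. \<forall>t\<in>{1..c}. sigma i t = \<alpha> (std_sigma i t))))
     \<and> (n \<noteq> 6 \<longrightarrow>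
          (\<forall>rho sigma. UW_epi (sym_group n) n c rho sigma \<longrightarrow>
            (\<exists>p \<in> carrier (sym_group n).
               (\<forall>i\<in>{1..<n}. rho i = conj_by (sym_group n) p (std_rho i)) \<and>
               (\<forall>i\<in>{1..<n}. \<forall>t\<in>{1..c}. sigma i t = conj_by (sym_group n) p (std_sigma i t)))))
     \<and> (n = 6 \<longrightarrow>
          (\<exists>\<alpha> \<in> iso (sym_group n) (sym_group n).
             \<not> (\<exists>p \<in> carrier (sym_group n).
                  (\<forall>i\<in>{1..<n}. \<alpha> (std_rho i) = conj_by (sym_group n) p (std_rho i)) \<and>
                  (\<forall>i\<in>{1..<n}. \<forall>t\<in>{1..c}. \<alpha> (std_sigma i t) = conj_by (sym_group n) p (std_sigma i t)))))"
proof (intro conjI allI impI)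
  have sigma_rho: "std_sigma i t = std_rho i" for i t
    by (simp add: std_rho_def std_sigma_def)
  show "UW_quotient (sym_group n) n c" by (rule UW_quotient_sym_group)
  {
    fix G :: "('g, 'b) monoid_scheme"
    assume G: "group G \<and> finite (carrier G) \<and> \<not> comm_group G \<and> UW_quotient G n c"
    then obtain rho sigma where "UW_epi G n c rho sigma" unfolding UW_quotient_def by blast
    then obtain f where f: "f \<in> hom (sym_group n) G" "inj_on f (carrier (sym_group n))"
      using UW_epi_embedding[OF _ assms(1)] G by metis
    have "f ` carrier (sym_group n) \<subseteq> carrier G" using f(1) by (auto simp: hom_def)
    then have "card (carrier (sym_group n)) \<le> card (carrier G)"
      using card_inj_on_le[OF f(2)] G by blast
    then show "fact n \<le> card (carrier G)" by (simp add: sym_group_card_carrier)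
    assume "card (carrier G) = fact n"
    then have "f \<in> iso (sym_group n) G" using inj_hom_sym_group_iso[OF f] G by blast
    then show "G \<cong> sym_group n"
      using group.iso_sym[OF sym_group_is_group] by (auto simp: is_iso_def)
  }
  fix rho sigma
  assume epi: "UW_epi (sym_group n) n c rho sigma"
  obtain f where f: "f \<in> iso (sym_group n) (sym_group n)"
    "\<forall>i\<in>{1..<n}. rho i = f (std_rho i)"
    "\<forall>i\<in>{1..<n}. \<forall>t\<in>{1..c}. sigma i t = f (std_rho i)"
    by (rule UW_epi_sym_group[OF epi assms(1)])
  show "\<exists>\<alpha>\<in>iso (sym_group n) (sym_group n). (\<forall>i\<in>{1..<n}. rho i = \<alpha> (std_rho i)) \<and>
      (\<forall>i\<in>{1..<n}. \<forall>t\<in>{1..c}. sigma i t = \<alpha> (std_sigma i t))"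
    unfolding sigma_rho using f by blast
  assume "n \<noteq> 6"
  then obtain p where "p \<in> carrier (sym_group n)"
    "\<forall>i\<in>{1..<n}. f (std_rho i) = conj_by (sym_group n) p (std_rho i)"
    using sym_group_iso_inner[OF f(1) assms(1)] by blast
  then show "\<exists>p\<in>carrier (sym_group n).
      (\<forall>i\<in>{1..<n}. rho i = conj_by (sym_group n) p (std_rho i)) \<and>
      (\<forall>i\<in>{1..<n}. \<forall>t\<in>{1..c}. sigma i t = conj_by (sym_group n) p (std_sigma i t))"
    unfolding sigma_rho using f(2,3) by auto
next
  assume "n = 6"
  then show "\<exists>\<alpha>\<in>iso (sym_group n) (sym_group n). \<not> (\<exists>p\<in>carrier (sym_group n).
      (\<forall>i\<in>{1..<n}. \<alpha> (std_rho i) = conj_by (sym_group n) p (std_rho i)) \<and>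
      (\<forall>i\<in>{1..<n}. \<forall>t\<in>{1..c}. \<alpha> (std_sigma i t) = conj_by (sym_group n) p (std_sigma i t)))"
    \<comment> \<open>The image of \<open>std_rho 1\<close> alone rules out every conjugating
      \<open>p\<close>.\<close>
    using sym_group_6_outer by force
qed

end
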